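(* Let $0<b<1$ and let $C_{-b}$ be the Chebyshev's method of $p_{-b}(z)=(z^2-1)(z^2+b)$. All immediate basins corresponding to the superattracting fixed points of $C_{-b}$ are unbounded.
   Context: For a polynomial $p$, the Chebyshev's method of $p$ is the rational map $C_p(z)=z-\left[1+\frac12 L_p(z)\right]\frac{p(z)}{p'(z)}$ with $L_p(z)=\frac{p(z)p''(z)}{(p'(z))^2}$, regarded as a self-map of the Riemann sphere $\widehat{\mathbb C}$. Write $C_{-b}:=C_{p_{-b}}$. The superattracting fixed points of $C_{-b}$ are the roots $1,-1,i\sqrt b,-i\sqrt b$ of $p_{-b}$. The immediate basin corresponding to such a fixed point is the Fatou component of $C_{-b}$ (connected component of the set of normality of $\{C_{-b}^n\}_{n>0}$) containing it. *)

theory Defs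
  imports
    "HOL-Analysis.Analysis"
    "HOL-Computational_Algebra.Computational_Algebra"
    "HOL-Computational_Algebra.Field_as_Ring"
begin

datatype riemann_sphere = Pt complex | Infty

text \<open>Inverse of the stereographic projection, onto the unit sphere in \<open>\<complex> \<times> \<real>\<close>.\<close>

fun stereo :: "riemann_sphere \<Rightarrow> complex \<times> real" where
  "stereo (Pt z) = ((2 / (1 + (cmod z)\<^sup>2)) *\<^sub>R z, ((cmod z)\<^sup>2 - 1) / ((cmod z)\<^sup>2 + 1))"
| "stereo Infty = (0, 1)"

lemma stereo_inject: "stereo v = stereo w \<Longrightarrow> v = w"
proof -
  have height: "((cmod z)\<^sup>2 - 1) / ((cmod z)\<^sup>2 + 1) = 1 - 2 / (1 + (cmod z)\<^sup>2)" for z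
  proof -
    have "1 + (cmod z)\<^sup>2 \<noteq> 0"
      by (smt (verit) zero_le_power2)
    then show ?thesis
      by (simp add: divide_simps)
  qed
  have pos: "2 / (1 + (cmod z)\<^sup>2) \<noteq> 0" for z
    by (smt (verit) zero_le_power2 divide_eq_0_iff)
  have ne: "stereo (Pt z) \<noteq> stereo Infty" for z
    unfolding stereo.simps height prod.inject using pos[of z] by linarith
  have inj: "z = z'" if eq: "stereo (Pt z) = stereo (Pt z')" for z z'
  proof -
    from eq have 1: "(2 / (1 + (cmod z)\<^sup>2)) *\<^sub>R z = (2 / (1 + (cmod z')\<^sup>2)) *\<^sub>R z'"
      and 2: "1 - 2 / (1 + (cmod z)\<^sup>2) = 1 - 2 / (1 + (cmod z')\<^sup>2)"
      unfolding stereo.simps height prod.inject by blast+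
    from 2 have "2 / (1 + (cmod z)\<^sup>2) = 2 / (1 + (cmod z')\<^sup>2)"
      by linarith
    with 1 have "(2 / (1 + (cmod z)\<^sup>2)) *\<^sub>R z = (2 / (1 + (cmod z)\<^sup>2)) *\<^sub>R z'"
      by (simp only:)
    then show ?thesis
      using pos[of z] by (rule scaleR_left_imp_eq[rotated])
  qed
  assume eq: "stereo v = stereo w"
  show "v = w"
  proof (cases v)
    case v: (Pt z)
    show ?thesis
    proof (cases w)
      case (Pt z')
      with eq v inj show ?thesis by blast
    next
      case Infty
      with eq v ne[of z] show ?thesis by (simp only:) 
    qed
  next
    case v: Infty
    show ?thesis
    proof (cases w)
      case (Pt z')
      with eq v ne[of z'] show ?thesis by (simp only:)
    next
      case Infty
      with v show ?thesis by (simp only:)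
    qed
  qed
qed

instantiation riemann_sphere :: metric_space
begin

definition dist_riemann_sphere :: "riemann_sphere \<Rightarrow> riemann_sphere \<Rightarrow> real" where
  "dist_riemann_sphere v w = dist (stereo v) (stereo w)"

definition uniformity_riemann_sphere :: "(riemann_sphere \<times> riemann_sphere) filter" where
  "uniformity_riemann_sphere = (INF e\<in>{0<..}. principal {(v, w). dist v w < e})"

definition open_riemann_sphere :: "riemann_sphere set \<Rightarrow> bool" where
  "open_riemann_sphere U =
     (\<forall>v\<in>U. eventually (\<lambda>(v', w). v' = v \<longrightarrow> w \<in> U) uniformity)"

instance
proof
  fix u v w :: riemann_sphere
  show "(dist v w = 0) = (v = w)"
    by (auto simp: dist_riemann_sphere_def dest: stereo_inject)
  show "dist v w \<le> dist v u + dist w u"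
    by (simp add: dist_riemann_sphere_def dist_triangle2)
qed (simp_all only: uniformity_riemann_sphere_def open_riemann_sphere_def)

end

text \<open>\<^const>\<open>quot_of_fract\<close> gives a coprime pair, so the numerator and the denominator have no
  common zero.  If the numerator has smaller degree than the denominator, the quotient of
  coefficients at \<open>\<infinity>\<close> is \<open>0\<close>.\<close>

definition rational_map :: "complex poly fract \<Rightarrow> riemann_sphere \<Rightarrow> riemann_sphere" where
  "rational_map r w =
     (let (P, Q) = quot_of_fract r in
      case w of
        Pt z \<Rightarrow> if poly Q z = 0 then Infty else Pt (poly P z / poly Q z)
      | Infty \<Rightarrow> if degree P > degree Q then Infty
                 else Pt (coeff P (degree Q) / coeff Q (degree Q)))"

text \<open>The formulas are evaluated in the field of rational functions \<open>\<complex>(z)\<close>.\<close>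

definition cheb_L :: "complex poly \<Rightarrow> complex poly fract" where
  "cheb_L p = to_fract p * to_fract (pderiv (pderiv p)) / (to_fract (pderiv p))\<^sup>2"

definition chebyshev_fract :: "complex poly \<Rightarrow> complex poly fract" where
  "chebyshev_fract p =
     to_fract [:0, 1:] - (1 + 1 / 2 * cheb_L p) * (to_fract p / to_fract (pderiv p))"

definition chebyshev_method :: "complex poly \<Rightarrow> riemann_sphere \<Rightarrow> riemann_sphere" where
  "chebyshev_method p = rational_map (chebyshev_fract p)"

fun sphere_inversion :: "riemann_sphere \<Rightarrow> riemann_sphere" where
  "sphere_inversion (Pt z) = (if z = 0 then Infty else Pt (inverse z))"
| "sphere_inversion Infty = Pt 0"

text \<open>The value at \<^const>\<open>Infty\<close> is arbitrary.  It does not matter below, where the argument lies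
  near a finite point.\<close>

fun affine_coord :: "riemann_sphere \<Rightarrow> complex" where
  "affine_coord (Pt z) = z"
| "affine_coord Infty = 0"

text \<open>A fixed point is superattracting if its multiplier is \<open>0\<close>.  At \<open>\<infinity>\<close> the multiplier is taken in
  the coordinate \<open>1/z\<close>.\<close>

definition superattracting_fixed_point ::
    "(riemann_sphere \<Rightarrow> riemann_sphere) \<Rightarrow> riemann_sphere \<Rightarrow> bool" where
  "superattracting_fixed_point f w \<longleftrightarrow>
     f w = w \<and>
     (case w of
        Pt z \<Rightarrow> ((\<lambda>u. affine_coord (f (Pt u))) has_field_derivative 0) (at z)
      | Infty \<Rightarrow> ((\<lambda>u. affine_coord (sphere_inversion (f (sphere_inversion (Pt u)))))
                   has_field_derivative 0) (at 0))"

definition normal_on ::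
    "riemann_sphere set \<Rightarrow> (riemann_sphere \<Rightarrow> riemann_sphere) set \<Rightarrow> bool" where
  "normal_on U F \<longleftrightarrow>
     (\<forall>s :: nat \<Rightarrow> riemann_sphere \<Rightarrow> riemann_sphere. (\<forall>n. s n \<in> F) \<longrightarrow>
        (\<exists>(r :: nat \<Rightarrow> nat) g. strict_mono r \<and>
           (\<forall>K. compact K \<and> K \<subseteq> U \<longrightarrow> uniform_limit K (s \<circ> r) g sequentially)))"

definition fatou_set :: "(riemann_sphere \<Rightarrow> riemann_sphere) \<Rightarrow> riemann_sphere set" where
  "fatou_set f = \<Union> {U. open U \<and> normal_on U {f ^^ n | n. n > 0}}"

definition immediate_basin ::
    "(riemann_sphere \<Rightarrow> riemann_sphere) \<Rightarrow> riemann_sphere \<Rightarrow> riemann_sphere set" where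
  "immediate_basin f w = connected_component_set (fatou_set f) w"

definition unbounded_in_plane :: "riemann_sphere set \<Rightarrow> bool" where
  "unbounded_in_plane U \<longleftrightarrow> \<not> bounded {z. Pt z \<in> U}"

definition p_minus :: "real \<Rightarrow> complex poly" where
  "p_minus b = [:-1, 0, 1:] * [:of_real b, 0, 1:]"

end

theory Submission
  imports Defs
begin

text \<open>
  Each root of \<open>z\<^sup>4 - a z\<^sup>2 - b\<close>, where \<open>a = 1 - b\<close>, has the form \<open>r e\<close> with \<open>r > 0\<close> and
  \<open>e\<^sup>2 = \<plusminus>1\<close>, and Chebyshev's method leaves the ray \<open>{t e. t \<ge> r}\<close> invariant: on it, it is the real
  Chebyshev map \<open>c\<close> of a quartic \<open>(t\<^sup>2 - r\<^sup>2) (t\<^sup>2 + k)\<close> with \<open>k > 0\<close>.  As \<open>r < c t < t\<close> for \<open>t > r\<close>,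
  all orbits on the ray converge to the root, so the ray lies in the immediate basin.

  The other fixed points are not superattracting: \<open>\<infinity>\<close> has multiplier \<open>32/21\<close>, and at an
  extraneous fixed point the two equations for \<open>t = z\<^sup>2\<close>, namely \<open>28 t\<^sup>2 - 8 a t + a\<^sup>2 = 0\<close> (critical) and
  \<open>22 t\<^sup>3 - 23 a t\<^sup>2 + (5 a\<^sup>2 - 6 b) t + a b = 0\<close> (fixed), force \<open>t\<close> to be real, whereas the first
  equation has no real solution.
\<close>

section \<open>Coordinates on the sphere and continuity in them\<close>

lemma continuous_stereo: "continuous_on A stereo"
  by (rule continuous_onI) (auto simp: dist_riemann_sphere_def)

text \<open>This is stereographic projection from the north pole, so \<open>affine_coord\<close>
  inherits continuity from \<open>stereo\<close> wherever the height differs from 1. At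
  \<open>Infty\<close> both sides are 0, in agreement with the default value.\<close>

lemma affine_coord_stereo:
  "affine_coord v = (1 / (1 - snd (stereo v))) *\<^sub>R fst (stereo v)"
proof (cases v)
  case (Pt z)
  have "1 + (cmod z)\<^sup>2 > 0" by (simp add: add_pos_nonneg)
  then have "1 - ((cmod z)\<^sup>2 - 1) / ((cmod z)\<^sup>2 + 1) = 2 / (1 + (cmod z)\<^sup>2)"
    and "2 / (1 + (cmod z)\<^sup>2) \<noteq> 0"
    by (auto simp: divide_simps)
  then show ?thesis using Pt by simp
qed simp

lemma snd_stereo_eq_1_iff: "snd (stereo v) = 1 \<longleftrightarrow> v = Infty"
proof (cases v)
  case (Pt z)
  have "1 + (cmod z)\<^sup>2 > 0" by (simp add: add_pos_nonneg)
  then show ?thesis using Pt by (auto simp: divide_simps)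
qed simp

text \<open>Distances on the sphere are pulled back along \<open>stereo\<close>, so it suffices that
  \<open>stereo\<close> composed with \<open>Pt\<close> is continuous.\<close>

lemma isCont_Pt: "isCont Pt z"
proof -
  have "continuous_on UNIV (\<lambda>z. stereo (Pt z))"
    by (auto intro!: continuous_intros simp: add_nonneg_eq_0_iff add.commute)
  then have "((\<lambda>u. stereo (Pt u)) \<longlongrightarrow> stereo (Pt z)) (at z)"
    by (simp add: continuous_on_def)
  then show ?thesis
    unfolding isCont_def tendsto_iff dist_riemann_sphere_def .
qed

lemma isCont_affine_coord:
  assumes "v \<noteq> Infty"
  shows "isCont affine_coord v"
proof -
  have "isCont stereo v"
    using continuous_stereo[of UNIV] by (simp add: continuous_on_eq_continuous_at)
  then have "isCont (\<lambda>v. (1 / (1 - snd (stereo v))) *\<^sub>R fst (stereo v)) v"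
    using assms snd_stereo_eq_1_iff[of v] by (auto intro!: continuous_intros)
  then show ?thesis by (subst affine_coord_stereo[abs_def])
qed

lemma open_Compl_Infty: "open (- {Infty :: riemann_sphere})"
  by (simp add: open_closed)

lemma eventually_Pt_affine_coord: "eventually (\<lambda>v. Pt (affine_coord v) = v) (nhds (Pt z))"
proof -
  have "eventually (\<lambda>v. v \<in> - {Infty}) (nhds (Pt z))"
    by (rule eventually_nhds_in_open[OF open_Compl_Infty]) simp
  then show ?thesis
  proof eventually_elim
    case (elim v)
    then show ?case by (cases v) auto
  qed
qed

text \<open>Neighbourhoods of \<open>z\<close> in the plane become neighbourhoods of
  \<open>Pt z\<close> because \<open>affine_coord\<close> is a continuous local inverse of
  \<open>Pt\<close>.\<close>

lemma eventually_nhds_Pt: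
  assumes "eventually P (nhds z)"
  shows "eventually (\<lambda>v. \<exists>u. v = Pt u \<and> P u) (nhds (Pt z))"
proof -
  have "filterlim affine_coord (nhds z) (nhds (Pt z))"
    using isCont_affine_coord[of "Pt z"]
    unfolding isCont_def tendsto_at_iff_tendsto_nhds by simp
  then have "eventually (\<lambda>v. P (affine_coord v)) (nhds (Pt z))"
    using assms by (auto simp: filterlim_iff)
  with eventually_Pt_affine_coord[of z] show ?thesis
    by eventually_elim metis
qed

lemma isCont_sphere_map:
  assumes "eventually (\<lambda>u. f (Pt u) = Pt (F u)) (nhds z)" and "isCont F z"
  shows "isCont f (Pt z)"
proof -
  have "isCont (\<lambda>v. Pt (F (affine_coord v))) (Pt z)"
    by (rule isCont_o2[OF isCont_o2[OF isCont_affine_coord] isCont_Pt]) (use assms in auto)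
  moreover have "eventually (\<lambda>v. f v = Pt (F (affine_coord v))) (nhds (Pt z))"
    using eventually_nhds_Pt[OF assms(1)] by eventually_elim auto
  ultimately show ?thesis by (simp add: isCont_cong)
qed

section \<open>Normality of iterates and the Fatou set\<close>

text \<open>An infinite fibre of \<open>k\<close> can be enumerated; if all fibres are finite,
  \<open>k\<close> itself tends to infinity. This handles the arbitrary exponents of a sequence
  taken from a family of iterates.\<close>

lemma nat_seq_subseq_const_or_at_top:
  fixes k :: "nat \<Rightarrow> nat"
  shows "(\<exists>(r :: nat \<Rightarrow> nat) c. strict_mono r \<and> (\<forall>n. k (r n) = c)) \<or>
    (\<exists>r :: nat \<Rightarrow> nat. strict_mono r \<and> filterlim (k \<circ> r) at_top sequentially)"
proof (cases "\<exists>c. infinite {n. k n = c}")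
  case True
  then obtain c where "infinite {n. k n = c}" by blast
  from infinite_enumerate[OF this] show ?thesis by blast
next
  case False
  have "eventually (\<lambda>n. Z \<le> k n) sequentially" for Z
  proof -
    have "{n. k n < Z} = (\<Union>c<Z. {n. k n = c})" by auto
    with False have "finite {n. \<not> Z \<le> k n}" by (simp add: not_le)
    then show ?thesis by (simp add: eventually_cofinite flip: cofinite_eq_sequentially)
  qed
  then have "filterlim (k \<circ> id) at_top sequentially" by (simp add: filterlim_at_top)
  then show ?thesis using strict_mono_id by blast
qed

text \<open>Along a subsequence the exponents are either constant, with a single iterate as limit,
  or tend to infinity, with the constant \<open>w\<close> as limit.\<close>

lemma normal_on_iterates:
  assumes "uniform_limit U (\<lambda>n. f ^^ n) (\<lambda>_. w) sequentially"
  shows "normal_on U {f ^^ n | n. n > 0}"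
  unfolding normal_on_def
proof (intro allI impI)
  fix s :: "nat \<Rightarrow> riemann_sphere \<Rightarrow> riemann_sphere"
  assume "\<forall>n. s n \<in> {f ^^ n | n. n > 0}"
  then have "\<forall>n. \<exists>k. s n = f ^^ k" by blast
  then obtain k where s: "\<And>n. s n = f ^^ k n" by metis
  show "\<exists>r g. strict_mono r \<and>
      (\<forall>K. compact K \<and> K \<subseteq> U \<longrightarrow> uniform_limit K (s \<circ> r) g sequentially)"
    using nat_seq_subseq_const_or_at_top[of k]
  proof (elim disjE exE conjE)
    fix r :: "nat \<Rightarrow> nat" and c
    assume r: "strict_mono r" "\<forall>n. k (r n) = c"
    then have "uniform_limit K (s \<circ> r) (f ^^ c) sequentially" for K
      by (simp add: uniform_limit_iff s)
    with r show ?thesis by blast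
  next
    fix r :: "nat \<Rightarrow> nat"
    assume r: "strict_mono r" "filterlim (k \<circ> r) at_top sequentially"
    have "uniform_limit U (s \<circ> r) (\<lambda>_. w) sequentially"
      using filterlim_compose[OF assms r(2)] by (simp add: s o_def)
    with r show ?thesis by (blast intro: uniform_limit_on_subset)
  qed
qed

lemma isCont_funpow:
  fixes f :: "'a::t2_space \<Rightarrow> 'a"
  assumes "\<And>k. k < n \<Longrightarrow> isCont f ((f ^^ k) v)"
  shows "isCont (f ^^ n) v"
  using assms
proof (induction n)
  case (Suc n)
  have "isCont (\<lambda>x. f ((f ^^ n) x)) v"
    by (rule isCont_o2[of v "f ^^ n" f]) (use Suc in auto)
  then show ?case by (simp add: o_def)
qed (simp add: id_def)

text \<open>Some iterate maps \<open>v\<close> into the interior of \<open>B\<close> and, by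
  continuity, maps a whole neighbourhood of \<open>v\<close> there; the later iterates then converge
  uniformly on that neighbourhood. Continuity is required along the orbit only, so poles need not be
  treated.\<close>

lemma fatou_set_orbit_tendsto:
  assumes cont: "\<And>n. isCont f ((f ^^ n) v)"
    and orbit: "(\<lambda>n. (f ^^ n) v) \<longlonglongrightarrow> w"
    and B: "eventually (\<lambda>x. x \<in> B) (nhds w)"
    and unif: "uniform_limit B (\<lambda>n. f ^^ n) (\<lambda>_. w) sequentially"
  shows "v \<in> fatou_set f"
proof -
  obtain V where V: "open V" "w \<in> V" "V \<subseteq> B"
    using B by (auto simp: eventually_nhds)
  have "eventually (\<lambda>n. (f ^^ n) v \<in> V) sequentially"
    using topological_tendstoD[OF orbit V(1,2)] .
  then obtain n where n: "(f ^^ n) v \<in> V" by (auto simp: eventually_sequentially)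
  have "isCont (f ^^ n) v" by (rule isCont_funpow) (rule cont)
  then obtain U where U: "open U" "v \<in> U" "\<And>u. u \<in> U \<Longrightarrow> (f ^^ n) u \<in> V"
    using V(1) n by (metis continuous_at_open)
  have "uniform_limit U (\<lambda>m. f ^^ (m + n)) (\<lambda>_. w) sequentially"
    unfolding uniform_limit_iff
  proof (intro allI impI)
    fix e :: real assume "e > 0"
    with unif have "eventually (\<lambda>m. \<forall>x\<in>B. dist ((f ^^ m) x) w < e) sequentially"
      by (simp add: uniform_limit_iff)
    then show "eventually (\<lambda>m. \<forall>x\<in>U. dist ((f ^^ (m + n)) x) w < e) sequentially"
      by eventually_elim (use U(3) V(3) in \<open>auto simp: funpow_add\<close>)
  qed
  then have "uniform_limit U (\<lambda>m. f ^^ m) (\<lambda>_. w) sequentially"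
    unfolding uniform_limit_iff
    by (subst eventually_sequentially_seg[symmetric, of _ n]) auto
  then have "normal_on U {f ^^ n | n. n > 0}" by (rule normal_on_iterates)
  with U show ?thesis by (auto simp: fatou_set_def)
qed

text \<open>A vanishing derivative makes the map halve distances to \<open>z\<close> on a small
  disc, so the iterates converge geometrically. The set \<open>B\<close> is the image of that
  disc.\<close>

lemma superattracting_uniform_limit:
  assumes "superattracting_fixed_point f (Pt z)" and cont: "isCont f (Pt z)"
  obtains B where "eventually (\<lambda>x. x \<in> B) (nhds (Pt z))"
    and "uniform_limit B (\<lambda>n. f ^^ n) (\<lambda>_. Pt z) sequentially"
proof -
  define G where "G u = affine_coord (f (Pt u))" for u
  have fp: "f (Pt z) = Pt z" and der: "(G has_field_derivative 0) (at z)"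
    using assms(1) by (auto simp: superattracting_fixed_point_def G_def[abs_def])
  have "G z = z" by (simp add: G_def fp)
  with der have "((\<lambda>u. (G u - z) / (u - z)) \<longlongrightarrow> 0) (at z)"
    by (simp add: has_field_derivative_iff)
  from tendstoD[OF this, of "1/2"]
  have "eventually (\<lambda>u. cmod ((G u - z) / (u - z)) < 1/2) (at z)" by simp
  then have ev1: "eventually (\<lambda>u. cmod (G u - z) \<le> cmod (u - z) / 2) (nhds z)"
    unfolding eventually_at_filter
    by eventually_elim (auto simp: \<open>G z = z\<close> norm_divide field_simps split: if_splits)
  \<comment> \<open>\<open>affine_coord\<close> sends \<open>Infty\<close> to 0, so the bound on
    \<open>G\<close> alone need not keep \<open>f (Pt u)\<close> finite; continuity of
    \<open>f\<close> does.\<close>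
  have "isCont (\<lambda>u. f (Pt u)) z" by (rule isCont_o2[OF isCont_Pt cont])
  then have "filterlim (\<lambda>u. f (Pt u)) (nhds (f (Pt z))) (nhds z)"
    using tendsto_at_iff_tendsto_nhds[of "\<lambda>u. f (Pt u)" z] by (simp add: isCont_def)
  then have "filterlim (\<lambda>u. f (Pt u)) (nhds (Pt z)) (nhds z)"
    by (simp only: fp)
  then have ev2: "eventually (\<lambda>u. Pt (G u) = f (Pt u)) (nhds z)"
    using eventually_Pt_affine_coord[of z] by (auto simp: filterlim_iff G_def)
  from eventually_conj[OF ev1 ev2] obtain d where "d > 0" and
    d: "\<And>u. dist u z < d \<Longrightarrow> cmod (G u - z) \<le> cmod (u - z) / 2 \<and> Pt (G u) = f (Pt u)"
    by (auto simp: eventually_nhds_metric)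
  have iter: "\<exists>u'. (f ^^ n) (Pt u) = Pt u' \<and> cmod (u' - z) \<le> cmod (u - z) / 2 ^ n"
    if "dist u z < d" for u n
  proof (induction n)
    case (Suc n)
    then obtain u' where u': "(f ^^ n) (Pt u) = Pt u'" "cmod (u' - z) \<le> cmod (u - z) / 2 ^ n"
      by blast
    have "cmod (u - z) / 2 ^ n \<le> cmod (u - z) / 1" by (rule divide_left_mono) auto
    with that u' have "dist u' z < d" by (simp add: dist_norm)
    have "cmod (G u' - z) \<le> cmod (u' - z) / 2" using d[OF \<open>dist u' z < d\<close>] by simp
    also have "\<dots> \<le> cmod (u - z) / 2 ^ n / 2" using u'(2) by (rule divide_right_mono) simp
    also have "\<dots> = cmod (u - z) / 2 ^ Suc n" by simp
    finally show ?case using d[OF \<open>dist u' z < d\<close>] u'(1) by (intro exI[of _ "G u'"]) simp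
  qed auto
  have "eventually (\<lambda>u. u \<in> ball z d) (nhds z)"
    by (rule eventually_nhds_in_open) (use \<open>d > 0\<close> in auto)
  then have "eventually (\<lambda>x. x \<in> Pt ` ball z d) (nhds (Pt z))"
    using eventually_nhds_Pt by (fastforce elim: eventually_mono)
  moreover have "uniform_limit (Pt ` ball z d) (\<lambda>n. f ^^ n) (\<lambda>_. Pt z) sequentially"
    unfolding uniform_limit_iff
  proof (intro allI impI)
    fix e :: real assume "e > 0"
    then obtain \<eta> where "\<eta> > 0" and \<eta>: "\<And>u. dist u z < \<eta> \<Longrightarrow> dist (Pt u) (Pt z) < e"
      using isCont_Pt[of z] by (auto simp: continuous_at_eps_delta)
    have "(\<lambda>n. d / 2 ^ n) \<longlonglongrightarrow> 0"
      using LIMSEQ_divide_realpow_zero[of 2 d] by simp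
    then have "eventually (\<lambda>n. d / 2 ^ n < \<eta>) sequentially"
      using \<open>\<eta> > 0\<close> by (rule order_tendstoD)
    then show "eventually (\<lambda>n. \<forall>x\<in>Pt ` ball z d. dist ((f ^^ n) x) (Pt z) < e) sequentially"
    proof eventually_elim
      case (elim n)
      show ?case
      proof safe
        fix u assume "u \<in> ball z d"
        then have u: "dist u z < d" by (simp add: dist_commute)
        then obtain u' where u': "(f ^^ n) (Pt u) = Pt u'" "cmod (u' - z) \<le> cmod (u - z) / 2 ^ n"
          using iter by blast
        have "cmod (u - z) / 2 ^ n \<le> d / 2 ^ n"
          using u by (intro divide_right_mono) (auto simp: dist_norm)
        then show "dist ((f ^^ n) (Pt u)) (Pt z) < e"
          using u' elim by (auto intro!: \<eta> simp: dist_norm)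
      qed
    qed
  qed
  ultimately show ?thesis by (rule that)
qed

section \<open>Chebyshev's method as a quotient of polynomials, and its quartic instance\<close>

text \<open>Allows evaluation without computing the reduced fraction: cross-multiplication compares
  \<open>P\<close> and \<open>Q\<close> with the coprime pair, whose members have no common
  zero.\<close>

lemma rational_map_quotient:
  assumes "Q \<noteq> 0" and r: "r = to_fract P / to_fract Q"
  shows rational_map_finite: "poly Q z \<noteq> 0 \<Longrightarrow> rational_map r (Pt z) = Pt (poly P z / poly Q z)"
    and rational_map_pole: "poly Q z = 0 \<Longrightarrow> poly P z \<noteq> 0 \<Longrightarrow> rational_map r (Pt z) = Infty"
proof -
  obtain P' Q' where PQ: "quot_of_fract r = (P', Q')" by fastforce
  have "Q' \<noteq> 0" and cop: "coprime P' Q'" and "r = Fract P' Q'"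
    using snd_quot_of_fract_nonzero[of r] coprime_quot_of_fract[of r] Fract_quot_of_fract[of r] PQ
    by auto
  with assms have "P * Q' = P' * Q"
    by (auto simp: to_fract_def eq_fract mult.commute)
  then have eq: "poly P z * poly Q' z = poly P' z * poly Q z"
    by (metis poly_mult)
  have nz: "poly P' z \<noteq> 0 \<or> poly Q' z \<noteq> 0"
    using cop coprime_poly_0 by blast
  show "rational_map r (Pt z) = Pt (poly P z / poly Q z)" if "poly Q z \<noteq> 0"
    using that eq nz by (auto simp: rational_map_def PQ divide_simps)
  show "rational_map r (Pt z) = Infty" if "poly Q z = 0" "poly P z \<noteq> 0"
    using that eq by (auto simp: rational_map_def PQ)
qed

text \<open>Over the common denominator \<open>2 * p' ^ 3\<close>, a zero of \<open>p'\<close>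
  leaves only the term \<open>- p^2 * p''\<close> in the numerator; if this is nonzero, the point is
  a pole.\<close>

lemma chebyshev_method_poly:
  assumes "pderiv p \<noteq> 0"
  shows chebyshev_method_finite: "poly (pderiv p) z \<noteq> 0 \<Longrightarrow> chebyshev_method p (Pt z) =
      Pt (z - poly p z / poly (pderiv p) z
            - (poly p z)\<^sup>2 * poly (pderiv (pderiv p)) z / (2 * poly (pderiv p) z ^ 3))"
    and chebyshev_method_pole: "poly (pderiv p) z = 0 \<Longrightarrow> poly p z \<noteq> 0 \<Longrightarrow>
      poly (pderiv (pderiv p)) z \<noteq> 0 \<Longrightarrow> chebyshev_method p (Pt z) = Infty"
proof -
  let ?p' = "pderiv p" and ?p'' = "pderiv (pderiv p)"
  define X :: "complex poly" where "X = [:0, 1:]"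
  define P where "P = 2 * X * ?p' ^ 3 - 2 * p * ?p'\<^sup>2 - p\<^sup>2 * ?p''"
  define Q where "Q = 2 * ?p' ^ 3"
  have "Q \<noteq> 0" using assms by (simp add: Q_def)
  have pow: "to_fract (x ^ n) = to_fract x ^ n" for x :: "complex poly" and n
    by (induction n) (simp_all add: One_fract_def[symmetric] to_fract_def[symmetric])
  have two: "to_fract (2 :: complex poly) = 2"
    by (metis one_add_one to_fract_1 to_fract_add)
  have two_nz: "(2 :: complex poly fract) \<noteq> 0"
    unfolding two[symmetric] by simp
  have nz: "to_fract ?p' \<noteq> 0" using assms by simp
  have "chebyshev_fract p = to_fract P / to_fract Q"
    using nz two_nz unfolding chebyshev_fract_def cheb_L_def P_def Q_def X_def[symmetric]
    by (simp add: pow two field_simps power2_eq_square power3_eq_cube)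
  note * = rational_map_quotient[OF \<open>Q \<noteq> 0\<close> this, folded chebyshev_method_def]
  show "chebyshev_method p (Pt z) = Pt (z - poly p z / poly ?p' z
          - (poly p z)\<^sup>2 * poly ?p'' z / (2 * poly ?p' z ^ 3))" if "poly ?p' z \<noteq> 0"
    using that *(1)[of z]
    by (simp add: P_def Q_def X_def field_simps power2_eq_square power3_eq_cube)
  show "chebyshev_method p (Pt z) = Infty"
    if "poly ?p' z = 0" "poly p z \<noteq> 0" "poly ?p'' z \<noteq> 0"
    using that *(2)[of z] by (simp add: P_def Q_def)
qed

text \<open>The Chebyshev map of \<open>x\<^sup>4 - \<alpha> x\<^sup>2 - \<beta>\<close>.  At a critical point it takes the junk value \<open>x\<close>.\<close>

definition cheb_quartic :: "'a::field \<Rightarrow> 'a \<Rightarrow> 'a \<Rightarrow> 'a" where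
  "cheb_quartic \<alpha> \<beta> x = x - (x ^ 4 - \<alpha> * x\<^sup>2 - \<beta>) / (4 * x ^ 3 - 2 * \<alpha> * x)
     - (x ^ 4 - \<alpha> * x\<^sup>2 - \<beta>)\<^sup>2 * (12 * x\<^sup>2 - 2 * \<alpha>) / (2 * (4 * x ^ 3 - 2 * \<alpha> * x) ^ 3)"

text \<open>Instance of the general formula
  \<open>p^2 * (3 * p''^2 - p' * p''') / (2 * p'^4)\<close> for the derivative of Chebyshev's
  method, with \<open>p''' = 24 * x\<close>.\<close>

lemma DERIV_cheb_quartic:
  fixes x :: "'a::real_normed_field"
  assumes nz: "4 * x ^ 3 - 2 * \<alpha> * x \<noteq> 0"
  shows "(cheb_quartic \<alpha> \<beta> has_field_derivative
    (x ^ 4 - \<alpha> * x\<^sup>2 - \<beta>)\<^sup>2 * (336 * x ^ 4 - 96 * \<alpha> * x\<^sup>2 + 12 * \<alpha>\<^sup>2)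
      / (2 * (4 * x ^ 3 - 2 * \<alpha> * x) ^ 4)) (at x)"
proof -
  define q where "q x = x ^ 4 - \<alpha> * x\<^sup>2 - \<beta>" for x
  define q1 where "q1 x = 4 * x ^ 3 - 2 * \<alpha> * x" for x
  define q2 where "q2 x = 12 * x\<^sup>2 - 2 * \<alpha>" for x
  have d: "(q has_field_derivative q1 x) (at x)" "(q1 has_field_derivative q2 x) (at x)"
      "(q2 has_field_derivative 24 * x) (at x)"
    unfolding q_def[abs_def] q1_def[abs_def] q2_def[abs_def]
    by (auto intro!: derivative_eq_intros simp: algebra_simps power2_eq_square power3_eq_cube)
  have "q1 x \<noteq> 0" using nz by (simp add: q1_def)
  have "((\<lambda>x. x - q x / q1 x - (q x)\<^sup>2 * q2 x / (2 * q1 x ^ 3)) has_field_derivative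
      1 - (q1 x * q1 x - q x * q2 x) / (q1 x * q1 x)
      - ((2 * q x * q1 x * q2 x + (q x)\<^sup>2 * (24 * x)) * (2 * q1 x ^ 3)
          - (q x)\<^sup>2 * q2 x * (2 * (3 * (q1 x)\<^sup>2 * q2 x))) / ((2 * q1 x ^ 3) * (2 * q1 x ^ 3))) (at x)"
    using \<open>q1 x \<noteq> 0\<close>
    by (auto intro!: derivative_eq_intros d simp: algebra_simps power2_eq_square)
  also have "1 - (q1 x * q1 x - q x * q2 x) / (q1 x * q1 x)
      - ((2 * q x * q1 x * q2 x + (q x)\<^sup>2 * (24 * x)) * (2 * q1 x ^ 3)
          - (q x)\<^sup>2 * q2 x * (2 * (3 * (q1 x)\<^sup>2 * q2 x))) / ((2 * q1 x ^ 3) * (2 * q1 x ^ 3))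
      = (q x)\<^sup>2 * (3 * (q2 x)\<^sup>2 - q1 x * (24 * x)) / (2 * q1 x ^ 4)"
    using \<open>q1 x \<noteq> 0\<close> by (simp add: field_simps power2_eq_square power3_eq_cube power4_eq_xxxx)
  also have "3 * (q2 x)\<^sup>2 - q1 x * (24 * x) = 336 * x ^ 4 - 96 * \<alpha> * x\<^sup>2 + 12 * \<alpha>\<^sup>2"
    by (simp add: q1_def q2_def algebra_simps power2_eq_square power3_eq_cube power4_eq_xxxx)
  finally show ?thesis by (simp add: cheb_quartic_def[abs_def] q_def q1_def q2_def)
qed

section \<open>Real dynamics to the right of the root \<open>r\<close> of
  \<open>(t^2 - r^2) * (t^2 + k)\<close>\<close>

context
  fixes r k \<alpha> \<beta> :: real
  assumes r: "r > 0" and k: "k > 0" and \<alpha>: "\<alpha> = r\<^sup>2 - k" and \<beta>: "\<beta> = r\<^sup>2 * k"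
begin

text \<open>The derivative equals \<open>2 * t * ((t^2 - r^2) + (t^2 + k))\<close>, so the
  denominators of the Chebyshev map do not vanish here.\<close>

lemma quartic_deriv_pos:
  assumes "r \<le> t"
  shows "4 * t ^ 3 - 2 * \<alpha> * t > 0"
proof -
  have "r\<^sup>2 \<le> t\<^sup>2" using r assms by (intro power_mono) auto
  then have "2 * t * ((t\<^sup>2 - r\<^sup>2) + (t\<^sup>2 + k)) > 0"
    using r k assms by (intro mult_pos_pos add_nonneg_pos) auto
  then show ?thesis by (simp add: \<alpha> algebra_simps power2_eq_square power3_eq_cube)
qed

lemma quartic_factor: "t ^ 4 - \<alpha> * t\<^sup>2 - \<beta> = (t\<^sup>2 - r\<^sup>2) * (t\<^sup>2 + k)"
  by (simp add: \<alpha> \<beta> algebra_simps power2_eq_square power4_eq_xxxx)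

lemma cheb_quartic_root: "cheb_quartic \<alpha> \<beta> r = r"
  by (simp add: cheb_quartic_def quartic_factor)

text \<open>The quartic and its first two derivatives are positive beyond \<open>r\<close>, so both
  correction terms lower \<open>t\<close>.\<close>

lemma cheb_quartic_less:
  assumes "r < t"
  shows "cheb_quartic \<alpha> \<beta> t < t"
proof -
  have sq: "r\<^sup>2 < t\<^sup>2" using r assms by (intro power_strict_mono) auto
  then have q: "t ^ 4 - \<alpha> * t\<^sup>2 - \<beta> > 0"
    unfolding quartic_factor using k by (intro mult_pos_pos) (auto intro: add_nonneg_pos)
  have q1: "4 * t ^ 3 - 2 * \<alpha> * t > 0" by (rule quartic_deriv_pos) (use assms in simp)
  have "10 * t\<^sup>2 + (2 * (t\<^sup>2 - r\<^sup>2) + 2 * k) > 0"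
    using sq k by (intro add_nonneg_pos add_pos_pos) auto
  then have "12 * t\<^sup>2 - 2 * \<alpha> > 0" by (simp add: \<alpha> algebra_simps)
  then have "(t ^ 4 - \<alpha> * t\<^sup>2 - \<beta>)\<^sup>2 * (12 * t\<^sup>2 - 2 * \<alpha>) / (2 * (4 * t ^ 3 - 2 * \<alpha> * t) ^ 3) > 0"
    using q q1 by (intro divide_pos_pos mult_pos_pos zero_less_power) auto
  moreover have "(t ^ 4 - \<alpha> * t\<^sup>2 - \<beta>) / (4 * t ^ 3 - 2 * \<alpha> * t) > 0"
    using q q1 by (rule divide_pos_pos)
  ultimately show ?thesis unfolding cheb_quartic_def by linarith
qed

text \<open>The map fixes \<open>r\<close> and is nondecreasing from there on, since its derivative
  is nonnegative.\<close>

lemma cheb_quartic_ge: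
  assumes "r \<le> t"
  shows "r \<le> cheb_quartic \<alpha> \<beta> t"
proof -
  have "cheb_quartic \<alpha> \<beta> r \<le> cheb_quartic \<alpha> \<beta> t"
  proof (rule DERIV_nonneg_imp_nondecreasing[OF assms])
    fix x assume x: "r \<le> x" "x \<le> t"
    \<comment> \<open>A sum of squares shows the sign of the second factor of the
      derivative.\<close>
    have "336 * x ^ 4 - 96 * \<alpha> * x\<^sup>2 + 12 * \<alpha>\<^sup>2 = 144 * x ^ 4 + 12 * (\<alpha> - 4 * x\<^sup>2)\<^sup>2"
      by (simp add: algebra_simps power2_eq_square power4_eq_xxxx)
    also have "\<dots> \<ge> 0" by simp
    finally have "336 * x ^ 4 - 96 * \<alpha> * x\<^sup>2 + 12 * \<alpha>\<^sup>2 \<ge> 0" .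
    then have "(x ^ 4 - \<alpha> * x\<^sup>2 - \<beta>)\<^sup>2 * (336 * x ^ 4 - 96 * \<alpha> * x\<^sup>2 + 12 * \<alpha>\<^sup>2)
        / (2 * (4 * x ^ 3 - 2 * \<alpha> * x) ^ 4) \<ge> 0"
      by (intro divide_nonneg_nonneg mult_nonneg_nonneg) auto
    moreover have "4 * x ^ 3 - 2 * \<alpha> * x \<noteq> 0" using quartic_deriv_pos[OF x(1)] by simp
    ultimately show "\<exists>y. (cheb_quartic \<alpha> \<beta> has_real_derivative y) (at x) \<and> 0 \<le> y"
      using DERIV_cheb_quartic by blast
  qed
  then show ?thesis by (simp add: cheb_quartic_root)
qed

lemma cheb_quartic_iterates_ge: "r \<le> t \<Longrightarrow> r \<le> (cheb_quartic \<alpha> \<beta> ^^ n) t"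
  by (induction n) (auto intro: cheb_quartic_ge)

text \<open>The orbit decreases and is bounded below by \<open>r\<close>; by continuity its limit is
  a fixed point, and no fixed point lies beyond \<open>r\<close>.\<close>

lemma cheb_quartic_iterates_tendsto:
  assumes "r \<le> t"
  shows "(\<lambda>n. (cheb_quartic \<alpha> \<beta> ^^ n) t) \<longlonglongrightarrow> r"
proof -
  define x where "x n = (cheb_quartic \<alpha> \<beta> ^^ n) t" for n
  have ge: "r \<le> x n" for n using cheb_quartic_iterates_ge[OF assms] by (simp add: x_def)
  have Suc: "x (Suc n) = cheb_quartic \<alpha> \<beta> (x n)" for n by (simp add: x_def)
  have "decseq x"
  proof (rule decseq_SucI)
    show "x (Suc n) \<le> x n" for n
      using ge[of n] cheb_quartic_less[of "x n"] cheb_quartic_root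
      by (cases "x n = r") (auto simp: Suc)
  qed
  then obtain L where L: "x \<longlonglongrightarrow> L" by (rule decseq_convergent) (use ge in auto)
  have "r \<le> L" using LIMSEQ_le_const[OF L] ge by blast
  have "isCont (cheb_quartic \<alpha> \<beta>) L"
    by (rule DERIV_isCont[OF DERIV_cheb_quartic]) (use quartic_deriv_pos[OF \<open>r \<le> L\<close>] in simp)
  then have "(\<lambda>n. x (Suc n)) \<longlonglongrightarrow> cheb_quartic \<alpha> \<beta> L"
    using L by (simp add: Suc isCont_tendsto_compose)
  then have "cheb_quartic \<alpha> \<beta> L = L" using L LIMSEQ_Suc LIMSEQ_unique by blast
  then have "L = r" using cheb_quartic_less[of L] \<open>r \<le> L\<close> by force
  with L show ?thesis by (simp add: x_def[abs_def])
qed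

end

section \<open>Reduction of the complex map on a ray to the real map\<close>

text \<open>The quartic depends on \<open>z^2 = s * t^2\<close> only, so its values on the ray are
  real, its first derivative gains a factor \<open>s * e\<close>, and its second a factor
  \<open>s\<close>. The sign \<open>s\<close> is absorbed into the coefficient
  \<open>a\<close>.\<close>

lemma quartic_ray:
  fixes e :: complex and a b s t :: real
  assumes e: "e\<^sup>2 = of_real s" and s: "s = 1 \<or> s = -1"
  defines "z \<equiv> of_real t * e"
  shows quartic_ray_deriv: "4 * z ^ 3 - 2 * of_real a * z = of_real (s * (4 * t ^ 3 - 2 * (s * a) * t)) * e"
    and cheb_quartic_ray: "cheb_quartic (of_real a) (of_real b) z = of_real (cheb_quartic (s * a) b t) * e"
proof -
  have ss: "s * s = 1" using s by auto
  have "z\<^sup>2 = of_real (s * t\<^sup>2)" by (simp add: z_def power_mult_distrib e)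
  moreover have "z ^ 4 = (z\<^sup>2)\<^sup>2" by simp
  moreover have "z ^ 3 = z\<^sup>2 * z" by (simp add: power2_eq_square power3_eq_cube)
  ultimately have z: "z\<^sup>2 = of_real (s * t\<^sup>2)" "z ^ 4 = of_real (t ^ 4)"
      "z ^ 3 = of_real (s * t ^ 3) * e"
    using s by (auto simp: z_def power2_eq_square power3_eq_cube power4_eq_xxxx)
  have q: "z ^ 4 - of_real a * z\<^sup>2 - of_real b = of_real (t ^ 4 - s * a * t\<^sup>2 - b)"
    by (simp add: z)
  show q1: "4 * z ^ 3 - 2 * of_real a * z = of_real (s * (4 * t ^ 3 - 2 * (s * a) * t)) * e"
    using s unfolding z(3) by (auto simp: z_def algebra_simps)
  have q2: "12 * z\<^sup>2 - 2 * of_real a = of_real (s * (12 * t\<^sup>2 - 2 * (s * a)))"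
    using s by (auto simp: z algebra_simps)
  have "e \<noteq> 0" using e s by auto
  have "e ^ 3 = of_real s * e" using e by (simp add: power2_eq_square power3_eq_cube)
  have ee: "e * (e * x) = of_real s * x" for x
    using e by (simp add: power2_eq_square flip: mult.assoc)
  \<comment> \<open>From \<open>s^2 = 1\<close> and \<open>e^2 = s\<close> follow
    \<open>1 / (s * e) = e\<close> and \<open>s / (s * e)^3 = e\<close>, so each correction term is
    a real multiple of \<open>e\<close>. For \<open>y = 0\<close> both sides are 0.\<close>
  have inv: "x / (of_real s * y * e) = x / y * e" for x y
    using s \<open>e \<noteq> 0\<close> by (cases "y = 0") (auto simp: field_simps ee)
  have inv3: "x * (of_real s * w) / (2 * (of_real s * y * e) ^ 3) = x * w / (2 * y ^ 3) * e" for x y w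
    using s \<open>e \<noteq> 0\<close> by (cases "y = 0") (auto simp: field_simps power2_eq_square power3_eq_cube ee)
  show "cheb_quartic (of_real a) (of_real b) z = of_real (cheb_quartic (s * a) b t) * e"
    unfolding cheb_quartic_def q q1 q2 unfolding of_real_mult[of s] inv inv3
    by (simp add: z_def algebra_simps)
qed

section \<open>Chebyshev's method of \<open>p_minus b\<close> at finite points\<close>

lemma p_minus_eq: "p_minus b = [:- of_real b, 0, - of_real (1 - b), 0, 1:]"
  by (simp add: p_minus_def)

lemma poly_p_minus:
  "poly (p_minus b) z = z ^ 4 - of_real (1 - b) * z\<^sup>2 - of_real b"
  "poly (pderiv (p_minus b)) z = 4 * z ^ 3 - 2 * of_real (1 - b) * z"
  "poly (pderiv (pderiv (p_minus b))) z = 12 * z\<^sup>2 - 2 * of_real (1 - b)"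
  by (simp_all add: p_minus_eq pderiv_pCons algebra_simps power2_eq_square power3_eq_cube
      power4_eq_xxxx)

lemma pderiv_p_minus_nonzero: "pderiv (p_minus b) \<noteq> 0"
  by (simp add: p_minus_eq pderiv_pCons)

lemma chebyshev_method_p_minus_finite:
  assumes "4 * z ^ 3 - 2 * of_real (1 - b) * z \<noteq> 0"
  shows "chebyshev_method (p_minus b) (Pt z) = Pt (cheb_quartic (of_real (1 - b)) (of_real b) z)"
  using chebyshev_method_finite[OF pderiv_p_minus_nonzero, of b z] assms
  unfolding poly_p_minus cheb_quartic_def by blast

text \<open>The critical points are 0 and the square roots of \<open>(1 - b) / 2\<close>. There the
  polynomial is \<open>- b\<close> or \<open>- ((1 + b) / 2)^2\<close>, and its second derivative
  \<open>- 2 * (1 - b)\<close> or \<open>4 * (1 - b)\<close>. Hence no critical point is a fixed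
  point.\<close>

lemma chebyshev_method_p_minus_pole:
  assumes "4 * z ^ 3 - 2 * of_real (1 - b) * z = 0" and "0 < b" and "b < 1"
  shows "chebyshev_method (p_minus b) (Pt z) = Infty"
proof -
  have "2 * z * (2 * z\<^sup>2 - of_real (1 - b)) = 0"
    using assms(1) by (simp add: algebra_simps power2_eq_square power3_eq_cube)
  then consider "z = 0" | "2 * z\<^sup>2 = of_real (1 - b)" by auto
  then have "poly (p_minus b) z \<noteq> 0 \<and> poly (pderiv (pderiv (p_minus b))) z \<noteq> 0"
  proof cases
    case 1
    then show ?thesis using assms unfolding poly_p_minus by simp
  next
    case 2
    then have z2: "z\<^sup>2 = of_real ((1 - b) / 2)" by (simp add: field_simps)
    have "z ^ 4 = (z\<^sup>2)\<^sup>2" by simp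
    then have "poly (p_minus b) z = of_real (((1 - b) / 2)\<^sup>2 - (1 - b) * ((1 - b) / 2) - b)"
      unfolding poly_p_minus z2 by simp
    moreover have "((1 - b) / 2)\<^sup>2 - (1 - b) * ((1 - b) / 2) - b = - ((1 + b) / 2)\<^sup>2"
      by (simp add: field_simps power2_eq_square)
    moreover have "poly (pderiv (pderiv (p_minus b))) z = of_real (4 * (1 - b))"
      unfolding poly_p_minus z2 by (simp add: field_simps)
    moreover have "- ((1 + b) / 2)\<^sup>2 \<noteq> 0" "4 * (1 - b) \<noteq> 0" using assms by auto
    ultimately show ?thesis by (simp only: of_real_eq_0_iff simp_thms)
  qed
  then show ?thesis
    using chebyshev_method_pole[OF pderiv_p_minus_nonzero] assms(1) by (simp add: poly_p_minus)
qed

section \<open>Superattracting fixed points are roots\<close>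

lemma cheb_quartic_superattracting:
  fixes z :: complex and a b :: real
  assumes "a > 0" and "b > 0"
    and D: "4 * z ^ 3 - 2 * of_real a * z \<noteq> 0"
    and fp: "cheb_quartic (of_real a) (of_real b) z = z"
    and der: "(cheb_quartic (of_real a) (of_real b) has_field_derivative 0) (at z)"
  shows "z ^ 4 - of_real a * z\<^sup>2 - of_real b = 0"
proof (rule ccontr)
  define t where "t = z\<^sup>2"
  define A B where "A = complex_of_real a" and "B = complex_of_real b"
  assume q: "z ^ 4 - of_real a * z\<^sup>2 - of_real b \<noteq> 0"
  have t: "z\<^sup>2 = t" "z ^ 4 = t\<^sup>2" by (simp_all add: t_def flip: power_mult)
  \<comment> \<open>The derivative of the quartic is odd in \<open>z\<close>, so its square is a
    polynomial in \<open>t\<close>.\<close>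
  have D2: "(4 * z ^ 3 - 2 * of_real a * z)\<^sup>2 = t * (4 * t - 2 * A)\<^sup>2"
    by (simp add: t_def A_def algebra_simps power2_eq_square power3_eq_cube)
  have "336 * z ^ 4 - 96 * of_real a * z\<^sup>2 + 12 * (of_real a)\<^sup>2 = (0 :: complex)"
    using DERIV_unique[OF DERIV_cheb_quartic[OF D] der] D q by auto
  then have "12 * (28 * t\<^sup>2 - (8 * A * t - A\<^sup>2)) = 0"
    unfolding t A_def[symmetric] by (simp add: algebra_simps)
  then have t2: "28 * t\<^sup>2 = 8 * A * t - A\<^sup>2"
    by (simp only: mult_eq_0_iff zero_neq_numeral[symmetric] simp_thms right_minus_eq)
  define x where "x = t\<^sup>2 - A * t - B"
  define y where "y = 4 * z ^ 3 - 2 * of_real a * z"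
  \<comment> \<open>At a fixed point the two correction terms cancel; dividing by the nonzero value
    \<open>x\<close> and clearing \<open>y\<close> gives the cubic equation \<open>G\<close> in
    \<open>t\<close>.\<close>
  have "x / y + x\<^sup>2 * (12 * t - 2 * A) / (2 * y ^ 3) = 0"
    using fp unfolding cheb_quartic_def t x_def y_def A_def B_def by (simp add: algebra_simps)
  moreover have "x \<noteq> 0" "y \<noteq> 0" using q D unfolding x_def y_def t A_def B_def by auto
  moreover have "x / y + x\<^sup>2 * w / (2 * y ^ 3) = x * (2 * y\<^sup>2 + x * w) / (2 * y ^ 3)"
    if "y \<noteq> 0" for w
    using that by (simp add: field_simps power2_eq_square power3_eq_cube)
  ultimately have "2 * y\<^sup>2 + x * (12 * t - 2 * A) = 0"
    by simp
  then have G: "2 * (t * (4 * t - 2 * A)\<^sup>2) + (t\<^sup>2 - A * t - B) * (12 * t - 2 * A) = 0"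
    unfolding y_def D2 x_def .
  \<comment> \<open>Division of 98 times the cubic by the quadratic has quotient
    \<open>154 * t - 117 * A\<close>; the remainder is linear in \<open>t\<close>, and its
    coefficient of \<open>t\<close> is nonzero as \<open>a\<close> and \<open>b\<close> are
    positive. So \<open>t\<close> is real.\<close>
  have "117 * A ^ 3 + 196 * A * B - (110 * A\<^sup>2 + 1176 * B) * t =
      98 * (2 * (t * (4 * t - 2 * A)\<^sup>2) + (t\<^sup>2 - A * t - B) * (12 * t - 2 * A))
      - (154 * t - 117 * A) * (28 * t\<^sup>2 - (8 * A * t - A\<^sup>2))"
    by (simp add: algebra_simps power2_eq_square power3_eq_cube)
  also have "\<dots> = 0" unfolding G t2 by simp
  finally have "(110 * A\<^sup>2 + 1176 * B) * t = 117 * A ^ 3 + 196 * A * B"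
    by simp
  then have "t * of_real (110 * a\<^sup>2 + 1176 * b) = of_real (117 * a ^ 3 + 196 * a * b)"
    by (simp add: A_def B_def mult.commute)
  moreover have nz: "110 * a\<^sup>2 + 1176 * b \<noteq> 0" using assms(1,2) by (smt (verit) zero_le_power2)
  ultimately have "t = of_real ((117 * a ^ 3 + 196 * a * b) / (110 * a\<^sup>2 + 1176 * b))"
    unfolding of_real_divide by (subst nonzero_eq_divide_eq) (use nz in \<open>simp_all only: of_real_eq_0_iff not_False_eq_True\<close>)
  then obtain \<tau> where \<tau>: "t = of_real \<tau>" by blast
  have "of_real (28 * \<tau>\<^sup>2) = (of_real (8 * a * \<tau> - a\<^sup>2) :: complex)"
    using t2 by (simp add: \<tau> A_def)
  then have "28 * \<tau>\<^sup>2 = 8 * a * \<tau> - a\<^sup>2" by (simp only: of_real_eq_iff)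
  \<comment> \<open>Completing the square in the quadratic, whose discriminant is negative.\<close>
  then have "28 * (\<tau> - a / 7)\<^sup>2 + 3 / 7 * a\<^sup>2 = 0"
    by (simp add: field_simps power2_eq_square)
  moreover have "3 / 7 * a\<^sup>2 > 0" using assms(1) by simp
  ultimately show False by (smt (verit) zero_le_power2)
qed

lemma isCont_cheb_quartic:
  fixes z :: "'a::real_normed_field"
  shows "4 * z ^ 3 - 2 * \<alpha> * z \<noteq> 0 \<Longrightarrow> isCont (cheb_quartic \<alpha> \<beta>) z"
  by (rule DERIV_isCont[OF DERIV_cheb_quartic])

lemma eventually_chebyshev_method_p_minus:
  assumes "4 * z ^ 3 - 2 * of_real (1 - b) * z \<noteq> 0"
  shows "eventually (\<lambda>u. chebyshev_method (p_minus b) (Pt u)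
           = Pt (cheb_quartic (of_real (1 - b)) (of_real b) u)) (nhds z)"
proof -
  have "open {u :: complex. 4 * u ^ 3 - 2 * of_real (1 - b) * u \<noteq> 0}"
    by (intro open_Collect_neq continuous_intros)
  then have "eventually (\<lambda>u. u \<in> {u. 4 * u ^ 3 - 2 * of_real (1 - b) * u \<noteq> 0}) (nhds z)"
    by (rule eventually_nhds_in_open) (use assms in simp)
  then show ?thesis
    by eventually_elim (use chebyshev_method_p_minus_finite in blast)
qed

text \<open>In the coordinate \<open>u = 1/z\<close> the map is \<open>u / H u\<close> near 0, and
  \<open>H 0 = 1 - 1/4 - 3/32 = 21/32\<close>.\<close>

lemma not_superattracting_Infty: "\<not> superattracting_fixed_point (chebyshev_method (p_minus b)) Infty"
proof
  define f where "f = chebyshev_method (p_minus b)"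
  define a :: complex where "a = of_real (1 - b)"
  define g where "g u = affine_coord (sphere_inversion (f (sphere_inversion (Pt u))))" for u
  \<comment> \<open>The quartic and its first two derivatives at \<open>1/u\<close>, multiplied by
    \<open>u^4\<close>, \<open>u^3\<close> and \<open>u^2\<close>.\<close>
  define A B C where "A u = 1 - a * u\<^sup>2 - of_real b * u ^ 4"
    and "B u = 4 - 2 * a * u\<^sup>2" and "C u = 12 - 2 * a * u\<^sup>2" for u :: complex
  define H where "H u = 1 - A u / B u - (A u)\<^sup>2 * C u / (2 * B u ^ 3)" for u
  assume "superattracting_fixed_point (chebyshev_method (p_minus b)) Infty"
  then have "f Infty = Infty" and der: "(g has_field_derivative 0) (at 0)"
    by (auto simp: superattracting_fixed_point_def g_def[abs_def] f_def)
  then have "g 0 = 0" by (simp add: g_def)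
  with der have lim0: "((\<lambda>u. g u / u) \<longlongrightarrow> 0) (at 0)"
    by (simp add: has_field_derivative_iff)
  have B0: "B 0 = 4" by (simp add: B_def)
  have contB: "isCont B 0" unfolding B_def[abs_def] by (intro continuous_intros)
  have "isCont A 0" "isCont C 0"
    unfolding A_def[abs_def] C_def[abs_def] by (intro continuous_intros)+
  with contB have "isCont H 0"
    unfolding H_def[abs_def] by (intro continuous_intros) (auto simp: B0)
  moreover have H0: "H 0 = 21 / 32"
    by (simp add: H_def A_def B_def C_def)
  ultimately have "isCont (\<lambda>u. inverse (H u)) 0"
    by (intro continuous_intros) auto
  then have limH: "((\<lambda>u. inverse (H u)) \<longlongrightarrow> 32 / 21) (at 0)"
    by (simp add: isCont_def H0)
  have "eventually (\<lambda>u. B u \<noteq> 0) (at 0)"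
    using contB B0 by (intro tendsto_imp_eventually_ne[of B 4]) (auto simp: isCont_def)
  then have "eventually (\<lambda>u. inverse (H u) = g u / u) (at 0)"
    using eventually_neq_at_within[of 0 0 UNIV]
  proof eventually_elim
    case (elim u)
    define z where "z = inverse u"
    have q: "z ^ 4 - a * z\<^sup>2 - of_real b = A u / u ^ 4"
      and q1: "4 * z ^ 3 - 2 * a * z = B u / u ^ 3"
      and q2: "12 * z\<^sup>2 - 2 * a = C u / u\<^sup>2"
      using elim by (simp_all add: z_def A_def B_def C_def field_simps power_inverse
          power2_eq_square power3_eq_cube power4_eq_xxxx)
    have "4 * z ^ 3 - 2 * a * z \<noteq> 0" unfolding q1 using elim by simp
    then have "f (Pt z) = Pt (cheb_quartic a (of_real b) z)"
      unfolding f_def a_def by (rule chebyshev_method_p_minus_finite)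
    also have "cheb_quartic a (of_real b) z = H u / u"
      unfolding cheb_quartic_def q q1 q2 H_def using elim
      by (simp add: z_def field_simps power2_eq_square power3_eq_cube power4_eq_xxxx)
    \<comment> \<open>If \<open>H u = 0\<close>, both sides are 0, by the default values of
      \<open>affine_coord Infty\<close> and \<open>inverse 0\<close>.\<close>
    finally show ?case using elim by (simp add: g_def z_def inverse_eq_divide)
  qed
  then have "((\<lambda>u. g u / u) \<longlongrightarrow> 32 / 21) (at 0)"
    using limH by (rule Lim_transform_eventually[rotated])
  with lim0 have "0 = (32 / 21 :: complex)" by (intro LIM_unique)
  then show False by simp
qed

section \<open>Invariant rays inside the immediate basins\<close>

text \<open>The conditions on \<open>r\<close> and \<open>k\<close> say that the real quartic on the
  ray through \<open>e\<close> factors as \<open>(t^2 - r^2) * (t^2 + k)\<close>. The ray from the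
  root outwards is connected and consists of Fatou points, so it lies in the component of the
  root.\<close>

lemma unbounded_immediate_basin_ray:
  fixes e :: complex and b r k s :: real
  assumes e: "e\<^sup>2 = of_real s" and s: "s = 1 \<or> s = -1"
    and r: "r > 0" and k: "k > 0" and \<alpha>: "s * (1 - b) = r\<^sup>2 - k" and \<beta>: "b = r\<^sup>2 * k"
    and sup: "superattracting_fixed_point (chebyshev_method (p_minus b)) (Pt (of_real r * e))"
  shows "unbounded_in_plane (immediate_basin (chebyshev_method (p_minus b)) (Pt (of_real r * e)))"
proof -
  define f where "f = chebyshev_method (p_minus b)"
  define c where "c = cheb_quartic (s * (1 - b)) b"
  define S where "S = (\<lambda>t. Pt (of_real t * e)) ` {r..}"
  note dyn = r k \<alpha> \<beta>
  have "norm (e\<^sup>2) = 1" using e s by auto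
  then have ne: "norm e = 1" by (simp add: norm_power power2_eq_1_iff) (smt (verit) norm_ge_zero)
  have D: "4 * (of_real t * e) ^ 3 - 2 * of_real (1 - b) * (of_real t * e) \<noteq> 0" if "r \<le> t" for t
  proof -
    have "s * (4 * t ^ 3 - 2 * (s * (1 - b)) * t) \<noteq> 0" and "e \<noteq> 0"
      using quartic_deriv_pos[OF dyn that] s ne by auto
    then show ?thesis
      unfolding quartic_ray_deriv[OF e s] by (simp only: mult_eq_0_iff of_real_eq_0_iff simp_thms)
  qed
  have step: "f (Pt (of_real t * e)) = Pt (of_real (c t) * e)" if "r \<le> t" for t
    unfolding f_def c_def chebyshev_method_p_minus_finite[OF D[OF that]] cheb_quartic_ray[OF e s] ..
  have cont: "isCont f (Pt (of_real t * e))" if "r \<le> t" for t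
    unfolding f_def
    by (rule isCont_sphere_map[OF eventually_chebyshev_method_p_minus isCont_cheb_quartic])
      (use D[OF that] in auto)
  have iter: "(f ^^ n) (Pt (of_real t * e)) = Pt (of_real ((c ^^ n) t) * e)" if "r \<le> t" for t n
    using cheb_quartic_iterates_ge[OF dyn that, folded c_def]
    by (induction n) (simp_all add: step)
  obtain B where B: "eventually (\<lambda>x. x \<in> B) (nhds (Pt (of_real r * e)))"
      "uniform_limit B (\<lambda>n. f ^^ n) (\<lambda>_. Pt (of_real r * e)) sequentially"
    using superattracting_uniform_limit[OF sup cont[of r, unfolded f_def]] unfolding f_def by auto
  have "S \<subseteq> fatou_set f"
  proof
    fix v assume "v \<in> S"
    then obtain t where t: "r \<le> t" and v: "v = Pt (of_real t * e)" by (auto simp: S_def)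
    have "(\<lambda>n. (c ^^ n) t) \<longlonglongrightarrow> r"
      unfolding c_def by (rule cheb_quartic_iterates_tendsto[OF dyn t])
    then have "(\<lambda>n. of_real ((c ^^ n) t) * e) \<longlonglongrightarrow> of_real r * e"
      by (intro tendsto_intros)
    then have "(\<lambda>n. (f ^^ n) v) \<longlonglongrightarrow> Pt (of_real r * e)"
      unfolding v iter[OF t] by (rule isCont_tendsto_compose[OF isCont_Pt])
    moreover have "isCont f ((f ^^ n) v)" for n
      unfolding v iter[OF t] c_def by (intro cont cheb_quartic_iterates_ge[OF dyn t])
    ultimately show "v \<in> fatou_set f" using B fatou_set_orbit_tendsto by blast
  qed
  moreover have "connected S"
    unfolding S_def
  proof (rule connected_continuous_image)
    have "isCont (\<lambda>t. Pt (of_real t * e)) t" for t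
      by (rule isCont_o2[OF _ isCont_Pt]) (intro continuous_intros)
    then show "continuous_on {r..} (\<lambda>t. Pt (of_real t * e))"
      by (simp add: continuous_at_imp_continuous_on)
  qed (simp add: connected_iff_interval)
  moreover have "Pt (of_real r * e) \<in> S" by (auto simp: S_def)
  ultimately have "S \<subseteq> immediate_basin f (Pt (of_real r * e))"
    unfolding immediate_basin_def by (intro connected_component_maximal)
  then have sub: "(\<lambda>t. of_real t * e) ` {r..} \<subseteq> {z. Pt z \<in> immediate_basin f (Pt (of_real r * e))}"
    by (auto simp: S_def)
  have "\<not> bounded ((\<lambda>t. of_real t * e) ` {r..})"
  proof
    assume "bounded ((\<lambda>t. of_real t * e) ` {r..})"
    then obtain M where "\<And>t. r \<le> t \<Longrightarrow> norm (of_real t * e) \<le> M"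
      by (auto simp: bounded_iff)
    \<comment> \<open>A parameter on the ray that exceeds the supposed bound
      \<open>M\<close>.\<close>
    from this[of "max r (\<bar>M\<bar> + 1)"] show False by (auto simp: norm_mult ne)
  qed
  then show ?thesis
    using bounded_subset[OF _ sub] by (auto simp: unbounded_in_plane_def f_def)
qed

theorem theorem3p12:
  fixes b :: real and w :: riemann_sphere
  assumes "0 < b" and "b < 1"
    and "superattracting_fixed_point (chebyshev_method (p_minus b)) w"
  shows "unbounded_in_plane (immediate_basin (chebyshev_method (p_minus b)) w)"
proof (cases w)
  case Infty
  with assms(3) not_superattracting_Infty show ?thesis by blast
next
  case (Pt z)
  let ?C = "cheb_quartic (of_real (1 - b)) (of_real b :: complex)"
  have fp: "chebyshev_method (p_minus b) (Pt z) = Pt z"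
    and der: "((\<lambda>u. affine_coord (chebyshev_method (p_minus b) (Pt u))) has_field_derivative 0) (at z)"
    using assms(3) by (auto simp: Pt superattracting_fixed_point_def)
  \<comment> \<open>A critical point would be sent to \<open>Infty\<close> and could not be
    fixed.\<close>
  have D: "4 * z ^ 3 - 2 * of_real (1 - b) * z \<noteq> 0"
    using chebyshev_method_p_minus_pole[OF _ assms(1,2), of z] fp by auto
  have "?C z = z" using fp chebyshev_method_p_minus_finite[OF D] by simp
  moreover have "eventually (\<lambda>u. affine_coord (chebyshev_method (p_minus b) (Pt u)) = ?C u) (nhds z)"
    using eventually_chebyshev_method_p_minus[OF D] by eventually_elim simp
  then have "(?C has_field_derivative 0) (at z)"
    by (rule iffD1[OF DERIV_cong_ev[OF refl _ refl], OF _ der])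
  ultimately have "z ^ 4 - of_real (1 - b) * z\<^sup>2 - of_real b = 0"
    using cheb_quartic_superattracting[of "1 - b" b z] D assms by auto
  then have "(z\<^sup>2 - 1) * (z\<^sup>2 + of_real b) = 0"
    by (simp add: algebra_simps power2_eq_square power4_eq_xxxx)
  then consider "z\<^sup>2 = 1" | "z\<^sup>2 = - of_real b" by (auto simp: eq_neg_iff_add_eq_0)
  then show ?thesis
  proof cases
    case 1
    \<comment> \<open>For the roots 1 and -1 the direction is \<open>z\<close> itself, with
      \<open>r = 1\<close> and \<open>k = b\<close>.\<close>
    then show ?thesis
      using unbounded_immediate_basin_ray[of z 1 1 b b] assms by (simp add: Pt)
  next
    case 2
    \<comment> \<open>The direction is \<open>i\<close> or \<open>-i\<close>, so
      \<open>s = -1\<close>, with \<open>r = sqrt b\<close> and \<open>k = 1\<close>.\<close>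
    define e where "e = z / of_real (sqrt b)"
    have z: "z = of_real (sqrt b) * e" using assms(1) by (simp add: e_def)
    have "(complex_of_real (sqrt b))\<^sup>2 = of_real b"
      using assms(1) by (simp flip: of_real_power)
    then have "e\<^sup>2 = of_real (- 1)"
      using 2 assms(1) by (simp add: e_def power_divide)
    then show ?thesis
      using unbounded_immediate_basin_ray[of e "-1" "sqrt b" 1 b] assms by (simp add: Pt z)
  qed
qed

end
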